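(* Let $f(t)=c_dt^d+\cdots+c_1t+c_0\in\mathbb{Z}[t]$, where $c_0$ and $c_1$ are relatively prime non-zero integers. If $f$ is irreducible and $c_0\neq\pm\alpha^k$ for any integer $\alpha$ and any natural number $k>1$, then $f$ is strongly irreducible.
   Context: A polynomial $f\in\mathbb{Q}[t]$ is strongly irreducible if $f(t^k)$ is irreducible in $\mathbb{Q}[t]$ for every positive integer $k$. *)

theory Defs
  imports "HOL-Computational_Algebra.Computational_Algebra"
begin

definition strongly_irreducible :: "rat poly \<Rightarrow> bool" where
  "strongly_irreducible f \<longleftrightarrow> (\<forall>k::nat. k > 0 \<longrightarrow> irreducible (pcompose f (monom 1 k)))"

end

theory Submission
  imports Defs Jordan_Normal_Form.Char_Poly
begin

text \<open>For a prime \<open>p\<close>, the ring \<open>\<int>[t]\<close> is free over \<open>\<int>[t\<^sup>p]\<close> with basis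
  \<open>1, t, \<dots>, t^(p-1)\<close>; let \<open>N\<close> be the norm, the determinant of multiplication. If
  \<open>f(t\<^sup>p) = A B\<close> then \<open>N(A) N(B) = f\<^sup>p\<close>, so \<open>N(A) = \<plusminus>f\<^sup>m\<close> for the prime element \<open>f\<close>. As \<open>A\<close> divides
  \<open>N(A)(t\<^sup>p)\<close>, the cases \<open>m = 0\<close> and \<open>m = p\<close> make \<open>A\<close> or \<open>B\<close> a unit. Otherwise \<open>m\<close> is coprime to \<open>p\<close>,
  and setting \<open>t = 0\<close> gives \<open>A(0)\<^sup>p = \<plusminus>f(0)\<^sup>m\<close>, whence \<open>f(0)\<close> is, up to sign, a \<open>p\<close>-th power. Since
  \<open>f(t\<^sup>p)\<close> has the same constant coefficient as \<open>f\<close>, the argument can be iterated over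
  the prime factors of \<open>k\<close>.\<close>

hide_const (open) module.smult

section \<open>Decomposing a polynomial by exponents modulo $p$\<close>

text \<open>The coordinate of \<open>A\<close> at the basis element \<open>t^r\<close>, with
  \<open>t^p\<close> renamed \<open>t\<close>. For \<open>p > 0\<close> the list is long enough,
  since \<open>n > degree A\<close> forces \<open>n * p + r > degree A\<close>.\<close>

definition multisect :: "nat \<Rightarrow> nat \<Rightarrow> 'a::comm_ring_1 poly \<Rightarrow> 'a poly" where
  "multisect p r A = Poly (map (\<lambda>n. coeff A (n * p + r)) [0..<Suc (degree A)])"

lemma coeff_multisect:
  assumes "p > 0"
  shows "coeff (multisect p r A) n = coeff A (n * p + r)"
proof (cases "n \<le> degree A")
  case True
  then show ?thesis
    by (simp add: multisect_def nth_default_def del: upt_Suc)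
next
  case False
  have "n \<le> n * p" using assms by simp
  then have "degree A < n * p + r" using False by linarith
  then show ?thesis using False
    by (simp add: multisect_def nth_default_def coeff_eq_0 del: upt_Suc)
qed

lemma coeff_pcompose_monom:
  fixes f :: "'a::comm_ring_1 poly"
  assumes "p > 0"
  shows "coeff (pcompose f (monom 1 p)) n = (if p dvd n then coeff f (n div p) else 0)"
proof (induction f arbitrary: n)
  case 0
  then show ?case by simp
next
  case (pCons a f)
  show ?case
  proof (cases "n < p")
    case True
    then show ?thesis using assms
      by (auto simp: pcompose_pCons coeff_monom_mult coeff_pCons dvd_imp_le split: nat.split
          dest: nat_dvd_not_less)
  next
    case False
    then obtain m where m: "n = p + m" using le_Suc_ex by (metis not_less)
    then show ?thesis using assms
      by (auto simp: pcompose_pCons coeff_monom_mult pCons.IH coeff_pCons split: nat.split)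
  qed
qed

lemma multisect_decomposition:
  assumes "p > 0"
  shows "A = (\<Sum>r<p. monom 1 r * pcompose (multisect p r A) (monom 1 p))"
proof (rule poly_eqI)
  fix n
  have "coeff (monom 1 r * pcompose (multisect p r A) (monom 1 p)) n =
      (if r = n mod p then coeff A n else 0)" if "r < p" for r
  proof (cases "r \<le> n")
    case True
    have "p dvd n - r \<longleftrightarrow> r = n mod p"
      using True that by (metis mod_eq_dvd_iff_nat mod_less)
    moreover have "(n - r) div p * p + r = n" if "p dvd n - r"
      using that True by simp
    ultimately show ?thesis
      using True assms by (simp add: coeff_monom_mult coeff_pcompose_monom coeff_multisect)
  next
    case False
    then have "r \<noteq> n mod p" by (metis mod_less_eq_dividend)
    then show ?thesis using False by (simp add: coeff_monom_mult)
  qed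
  then have "coeff (\<Sum>r<p. monom 1 r * pcompose (multisect p r A) (monom 1 p)) n
      = (\<Sum>r<p. if r = n mod p then coeff A n else 0)"
    by (simp add: coeff_sum)
  also have "\<dots> = coeff A n" using assms by simp
  finally show "coeff A n = coeff (\<Sum>r<p. monom 1 r * pcompose (multisect p r A) (monom 1 p)) n"
    by simp
qed

lemma multisect_sum:
  assumes "p > 0"
  shows "multisect p r (sum A I) = (\<Sum>i\<in>I. multisect p r (A i))"
  by (rule poly_eqI) (simp add: coeff_multisect[OF assms] coeff_sum)

text \<open>Multiplication by \<open>t^p\<close> preserves residues and only shifts each coordinate;
  Horner induction on \<open>B\<close> extends this to linearity over polynomials in
  \<open>t^p\<close>.\<close>

lemma multisect_mult_pcompose:
  assumes "r < p"
  shows "multisect p r (A * pcompose B (monom 1 p)) = multisect p r A * B"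
proof (induction B)
  case 0
  then show ?case using assms by (intro poly_eqI) (simp add: coeff_multisect)
next
  case (pCons b B)
  have p: "p > 0" using assms by simp
  have shift: "multisect p r (monom 1 p * X) = pCons 0 (multisect p r X)" for X :: "'a poly"
    by (rule poly_eqI)
      (use assms in \<open>auto simp: coeff_multisect coeff_monom_mult coeff_pCons split: nat.split\<close>)
  have "A * pcompose (pCons b B) (monom 1 p)
      = smult b A + monom 1 p * (A * pcompose B (monom 1 p))"
    by (simp add: pcompose_pCons algebra_simps)
  also have "multisect p r \<dots> = smult b (multisect p r A)
      + multisect p r (monom 1 p * (A * pcompose B (monom 1 p)))"
    by (rule poly_eqI) (simp add: coeff_multisect[OF p])
  also have "\<dots> = multisect p r A * pCons b B"
    by (simp only: shift pCons.IH) simp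
  finally show ?case .
qed

section \<open>The norm\<close>

text \<open>Column \<open>j\<close> holds the coordinates of \<open>A * t^j\<close>, so this is the
  matrix of multiplication by \<open>A\<close>.\<close>

definition mult_mat :: "nat \<Rightarrow> 'a::comm_ring_1 poly \<Rightarrow> 'a poly mat" where
  "mult_mat p A = mat p p (\<lambda>(i, j). multisect p i (A * monom 1 j))"

text \<open>The norm is written in the renamed variable; as an element of the larger ring it is
  \<open>pcompose (power_norm p A) (monom 1 p)\<close>.\<close>

definition power_norm :: "nat \<Rightarrow> 'a::comm_ring_1 poly \<Rightarrow> 'a poly" where
  "power_norm p A = det (mult_mat p A)"

lemma mult_mat_carrier [simp]: "mult_mat p A \<in> carrier_mat p p"
  by (simp add: mult_mat_def)

lemma multisect_mult:
  assumes "i < p"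
  shows "multisect p i (A * B) = (\<Sum>k<p. mult_mat p A $$ (i, k) * multisect p k B)"
proof -
  have p: "p > 0" using assms by simp
  have "A * B = (\<Sum>k<p. (A * monom 1 k) * pcompose (multisect p k B) (monom 1 p))"
    by (subst (1) multisect_decomposition[OF p, of B]) (simp add: sum_distrib_left mult.assoc)
  then show ?thesis
    using assms by (simp add: multisect_sum[OF p] multisect_mult_pcompose mult_mat_def)
qed

lemma multisect_pcompose_monom:
  assumes "i < p" "j < p"
  shows "multisect p i (monom 1 j * pcompose B (monom 1 p)) = (if i = j then B else 0)"
proof -
  have "multisect p i (monom 1 j) = (if i = j then 1 else 0 :: 'a poly)"
  proof (rule poly_eqI)
    fix n
    show "coeff (multisect p i (monom 1 j)) n = coeff (if i = j then 1 else 0 :: 'a poly) n"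
      using assms by (cases n) (auto simp: coeff_multisect coeff_1)
  qed
  then show ?thesis using assms by (simp add: multisect_mult_pcompose)
qed

lemma power_norm_mult: "power_norm p (A * B) = power_norm p A * power_norm p B"
proof -
  have "mult_mat p (A * B) = mult_mat p A * mult_mat p B"
  proof (rule eq_matI)
    fix i j assume "i < dim_row (mult_mat p A * mult_mat p B)" "j < dim_col (mult_mat p A * mult_mat p B)"
    then have ij: "i < p" "j < p" by (simp_all add: mult_mat_def)
    have "mult_mat p (A * B) $$ (i, j) = multisect p i (A * (B * monom 1 j))"
      using ij by (simp add: mult_mat_def mult.assoc)
    also have "\<dots> = (\<Sum>k<p. mult_mat p A $$ (i, k) * mult_mat p B $$ (k, j))"
      using ij by (subst multisect_mult) (simp_all add: mult_mat_def)
    also have "\<dots> = (mult_mat p A * mult_mat p B) $$ (i, j)"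
      using ij by (simp add: mult_mat_def scalar_prod_def atLeast0LessThan)
    finally show "mult_mat p (A * B) $$ (i, j) = (mult_mat p A * mult_mat p B) $$ (i, j)" .
  qed (simp_all add: mult_mat_def)
  then show ?thesis
    by (simp add: power_norm_def det_mult[of _ p])
qed

text \<open>A polynomial in \<open>t^p\<close> scales every basis element, so its matrix is
  \<open>f\<close> times the identity of size \<open>p\<close>.\<close>

lemma power_norm_pcompose: "power_norm p (pcompose f (monom 1 p)) = f ^ p"
proof -
  have "mult_mat p (pcompose f (monom 1 p)) = f \<cdot>\<^sub>m 1\<^sub>m p"
    by (rule eq_matI)
      (simp_all add: mult_mat_def multisect_pcompose_monom mult.commute[of _ "monom 1 _"])
  then show ?thesis by (simp add: power_norm_def)
qed

text \<open>At \<open>t = 0\<close>, entry \<open>(i, j)\<close> becomes coefficient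
  \<open>i\<close> of \<open>A * t^j\<close>, which vanishes above the diagonal and equals
  \<open>coeff A 0\<close> on it.\<close>

lemma poly_0_power_norm:
  "poly (power_norm p A) 0 = poly A 0 ^ p"
proof -
  have hom: "comm_ring_hom (\<lambda>q :: 'a poly. poly q 0)"
    by unfold_locales simp_all
  let ?M = "map_mat (\<lambda>q. poly q 0) (mult_mat p A)"
  have entry: "?M $$ (i, j) = (if i < j then 0 else coeff A (i - j))" if "i < p" "j < p" for i j
    using that
    by (auto simp: mult_mat_def poly_0_coeff_0 coeff_multisect coeff_monom_mult
        mult.commute[of A])
  have "poly (power_norm p A) 0 = det ?M"
    by (simp only: power_norm_def comm_ring_hom.hom_det[OF hom])
  also have "\<dots> = prod_list (diag_mat ?M)"
    by (rule det_lower_triangular[of p]) (simp_all add: entry del: index_map_mat)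
  also have "\<dots> = (\<Prod>i<p. ?M $$ (i, i))"
    by (simp add: prod_list_diag_prod mult_mat_def atLeast0LessThan)
  also have "\<dots> = (\<Prod>i<p. coeff A 0)"
    by (intro prod.cong refl) (simp add: entry del: index_map_mat)
  finally show ?thesis by (simp add: poly_0_coeff_0)
qed

text \<open>The cofactor is read off the first column of the adjugate matrix.\<close>

lemma dvd_power_norm:
  assumes "p > 0"
  shows "A dvd pcompose (power_norm p A) (monom 1 p)"
proof
  let ?M = "mult_mat p A"
  let ?w = "\<lambda>k. adj_mat ?M $$ (k, 0)"
  let ?B = "\<Sum>k<p. monom 1 k * pcompose (?w k) (monom 1 p)"
  have adj: "adj_mat ?M \<in> carrier_mat p p" by (simp add: adj_mat)
  have B: "multisect p k ?B = ?w k" if "k < p" for k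
  proof -
    have "multisect p k ?B = (\<Sum>j<p. if k = j then ?w j else 0)"
      using that by (simp add: multisect_sum[OF assms] multisect_pcompose_monom)
    also have "\<dots> = ?w k" using that by simp
    finally show ?thesis .
  qed
  \<comment> \<open>The coordinates of \<open>A * ?B\<close> form the first column of
    \<open>?M * adj_mat ?M\<close>, which is the norm times the identity.\<close>
  have "multisect p i (A * ?B) = (if i = 0 then power_norm p A else 0)" if "i < p" for i
  proof -
    have "multisect p i (A * ?B) = (\<Sum>k<p. ?M $$ (i, k) * ?w k)"
      using that by (simp add: multisect_mult B)
    also have "\<dots> = (?M * adj_mat ?M) $$ (i, 0)"
      using that adj assms by (simp add: scalar_prod_def atLeast0LessThan mult_mat_def)
    also have "\<dots> = (if i = 0 then power_norm p A else 0)"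
      using that assms by (simp add: adj_mat(2)[of _ p] power_norm_def)
    finally show ?thesis .
  qed
  then have "A * ?B = (\<Sum>i<p. monom 1 i * pcompose (if i = 0 then power_norm p A else 0) (monom 1 p))"
    by (subst multisect_decomposition[OF assms]) simp
  also have "\<dots> = (\<Sum>i<p. if i = 0 then pcompose (power_norm p A) (monom 1 p) else 0)"
    by (intro sum.cong refl) simp
  also have "\<dots> = pcompose (power_norm p A) (monom 1 p)"
    using assms by simp
  finally show "pcompose (power_norm p A) (monom 1 p) = A * ?B" by simp
qed

text \<open>Over a domain a unit polynomial is constant, so substituting \<open>t^p\<close> leaves
  the norm unchanged, and \<open>A\<close> divides it.\<close>

lemma is_unit_power_norm:
  fixes A :: "'a::idom_divide poly"
  assumes "p > 0" "is_unit (power_norm p A)"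
  shows "is_unit A"
proof -
  from assms(2) obtain c where "power_norm p A = [:c:]" "c dvd 1"
    by (auto simp: is_unit_poly_iff)
  then have "is_unit (pcompose (power_norm p A) (monom 1 p))"
    by (simp add: is_unit_const_poly_iff)
  then show ?thesis using dvd_power_norm[OF assms(1)] dvd_trans by blast
qed

section \<open>Substituting $t^k$\<close>

text \<open>If \<open>m * u = p * v + 1\<close>, then \<open>x\<close> is the quotient of the
  \<open>p\<close>-th powers of \<open>y ^ u\<close> and \<open>x ^ v\<close>. For
  \<open>p > 0\<close>, divisibility of \<open>p\<close>-th powers passes to their bases.\<close>

lemma perfect_power_of_coprime_exponents:
  fixes x y :: nat
  assumes "x \<noteq> 0" "m > 0" "coprime m p" "x ^ m = y ^ p"
  obtains z where "x = z ^ p"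
proof -
  obtain u v where uv: "m * u = p * v + 1"
    using bezout_nat[of m p] assms(2,3) by (auto simp: coprime_iff_gcd_eq_1)
  have "(y ^ u) ^ p = (x ^ m) ^ u"
    by (simp add: assms(4) mult.commute flip: power_mult)
  also have "\<dots> = x * (x ^ v) ^ p"
    by (simp add: uv mult.commute flip: power_mult)
  finally have eq: "(y ^ u) ^ p = x * (x ^ v) ^ p" .
  show thesis
  proof (cases "p = 0")
    case True
    then show ?thesis using that eq by simp
  next
    case False
    have "(x ^ v) ^ p dvd (y ^ u) ^ p" unfolding eq by simp
    then have "x ^ v dvd y ^ u" using False by (simp only: pow_divides_pow_iff)
    then obtain z where "y ^ u = x ^ v * z" ..
    then have "z ^ p = x" using eq assms(1) by (simp add: power_mult_distrib)
    then show ?thesis using that by blast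
  qed
qed

lemma irreducible_pcompose_prime:
  fixes f :: "int poly"
  assumes f: "irreducible f" and f0: "coeff f 0 \<noteq> 0"
    and not_power: "\<And>z. \<bar>coeff f 0\<bar> \<noteq> z ^ p"
    and p: "prime p"
  shows "irreducible (pcompose f (monom 1 p))"
proof (rule irreducibleI)
  have p0: "p > 0" using p by (simp add: prime_gt_0_nat)
  have "coeff (pcompose f (monom 1 p)) 0 \<noteq> 0"
    unfolding coeff_pcompose_monom[OF p0] using f0 by simp
  then show "pcompose f (monom 1 p) \<noteq> 0" by (metis coeff_0)
  show "\<not> is_unit (pcompose f (monom 1 p))"
  proof
    assume "is_unit (pcompose f (monom 1 p))"
    then have "poly (pcompose f (monom 1 p)) 0 dvd 1"
      by (auto simp: is_unit_poly_iff)
    \<comment> \<open>A unit has constant coefficient 1 or -1, and 1 is a \<open>p\<close>-th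
      power.\<close>
    then have "\<bar>coeff f 0\<bar> = 1 ^ p"
      using p0 by (simp add: poly_pcompose poly_monom poly_0_coeff_0)
    then show False using not_power by blast
  qed
  fix A B assume AB: "pcompose f (monom 1 p) = A * B"
  have N: "power_norm p A * power_norm p B = f ^ p"
    by (simp flip: AB power_norm_mult add: power_norm_pcompose)
  \<comment> \<open>Unique factorization over the integers makes \<open>f\<close> prime, so each
    divisor of \<open>f ^ p\<close> is a unit times a power of \<open>f\<close>.\<close>
  have prime_f: "prime (normalize f)"
    using f by (simp add: prime_def irreducible_imp_prime_elem prime_elem_normalize_iff)
  have "power_norm p A dvd normalize f ^ p"
    using N by (metis dvd_normalize_iff dvd_triv_left normalize_power)
  then obtain m where m: "m \<le> p" "normalize (power_norm p A) = normalize (normalize f ^ m)"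
    using divides_primepow_weak[OF prime_f] by blast
  then have "normalize (power_norm p A) = normalize (f ^ m)"
    by (simp add: normalize_power)
  then obtain u where u: "is_unit u" "power_norm p A = u * f ^ m"
    using associatedE1 by blast
  consider "m = 0" | "m = p" | "0 < m" "m < p" using m(1) by linarith
  then show "is_unit A \<or> is_unit B"
  proof cases
    case 1
    then show ?thesis using u p0 is_unit_power_norm by auto
  next
    case 2
    \<comment> \<open>The norm of \<open>A\<close> already absorbs \<open>f ^ p\<close>; cancelling
      it leaves a unit norm for \<open>B\<close>.\<close>
    have "f ^ p \<noteq> 0" using f0 by auto
    moreover have "f ^ p * (u * power_norm p B) = f ^ p * 1"
      using N by (simp add: u(2) 2 ac_simps)
    ultimately have "u * power_norm p B = 1" by (metis mult_left_cancel)
    then have "is_unit (power_norm p B)" by (metis dvd_triv_right)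
    then show ?thesis using p0 is_unit_power_norm by auto
  next
    case 3
    have "\<bar>poly u 0\<bar> = 1" using u(1) by (auto simp: is_unit_poly_iff)
    moreover have "coeff A 0 ^ p = poly u 0 * coeff f 0 ^ m"
      using poly_0_power_norm[of p A] by (simp add: u(2) flip: poly_0_coeff_0)
    ultimately have "\<bar>coeff f 0\<bar> ^ m = \<bar>coeff A 0\<bar> ^ p"
      by (metis abs_mult mult_1 power_abs)
    then have "nat \<bar>coeff f 0\<bar> ^ m = nat \<bar>coeff A 0\<bar> ^ p"
      by (metis abs_ge_zero nat_power_eq)
    moreover have "coprime m p"
      using p 3 by (metis coprime_commute nat_dvd_not_less prime_imp_coprime)
    ultimately obtain z where "nat \<bar>coeff f 0\<bar> = z ^ p"
      using perfect_power_of_coprime_exponents[of "nat \<bar>coeff f 0\<bar>" m p "nat \<bar>coeff A 0\<bar>"] 3 f0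
      by auto
    then have "\<bar>coeff f 0\<bar> = int z ^ p" by (metis abs_ge_zero int_nat_eq of_nat_power)
    then show ?thesis using not_power by blast
  qed
qed

text \<open>Strong induction on \<open>k\<close> with \<open>f\<close> arbitrary: a prime
  \<open>p\<close> is split off as \<open>k = p * l\<close>, and the hypothesis is applied to
  \<open>f(t^p)\<close> and \<open>l\<close>.\<close>

lemma irreducible_pcompose_power:
  fixes f :: "int poly"
  assumes "irreducible f" and "coeff f 0 \<noteq> 0"
    and "\<And>z k. k > 1 \<Longrightarrow> \<bar>coeff f 0\<bar> \<noteq> z ^ k"
    and "k > 0"
  shows "irreducible (pcompose f (monom 1 k))"
  using assms
proof (induction k arbitrary: f rule: less_induct)
  case (less k)
  show ?case
  proof (cases "k = 1")
    case True
    then show ?thesis using less.prems(1) by (simp add: monom_altdef)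
  next
    case False
    then obtain p l where p: "prime p" and k: "k = p * l"
      using prime_factor_nat by (meson dvdE)
    let ?g = "pcompose f (monom 1 p)"
    have "p > 1" using p by (rule prime_gt_1_nat)
    then have l: "l > 0" "l < k" using k less.prems(4) by auto
    have g0: "coeff ?g 0 = coeff f 0" using \<open>p > 1\<close> by (subst coeff_pcompose_monom) auto
    have g: "irreducible ?g"
      using less.prems(1,2) less.prems(3)[OF \<open>p > 1\<close>] p by (rule irreducible_pcompose_prime)
    have g_nz: "coeff ?g 0 \<noteq> 0"
      unfolding g0 by (rule less.prems(2))
    have g_not_power: "\<bar>coeff ?g 0\<bar> \<noteq> z ^ n" if "n > 1" for z n
      unfolding g0 using that by (rule less.prems(3))
    have "irreducible (pcompose ?g (monom 1 l))"
      using l(2) g g_nz g_not_power l(1) by (rule less.IH)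
    moreover have "pcompose (monom 1 p) (monom 1 l) = (monom 1 k :: int poly)"
      by (simp add: monom_altdef pcompose_smult pcompose_hom.hom_power k mult.commute
          flip: power_mult)
    ultimately show ?thesis by (simp flip: pcompose_assoc)
  qed
qed

section \<open>Passing between integer and rational coefficients\<close>

lemma clear_denominators:
  fixes G :: "rat poly"
  obtains a :: int and g where "a \<noteq> 0" "smult (of_int a) G = map_poly of_int g"
proof -
  have "\<exists>a g. a \<noteq> 0 \<and> smult (of_int a) G = map_poly of_int g"
  proof (induction G)
    case 0
    show ?case by (intro exI[of _ 1] exI[of _ 0]) simp
  next
    case (pCons c G)
    then obtain a g where ag: "a \<noteq> 0" "smult (of_int a) G = map_poly of_int g" by blast
    obtain n d where nd: "c = of_int n / of_int d" "d > 0"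
      by (metis quotient_of_div quotient_of_denom_pos surj_pair)
    \<comment> \<open>The denominator \<open>d\<close> of \<open>c\<close> joins the multiplier, and
      \<open>d * a * c = a * n\<close>.\<close>
    have "smult (of_int (d * a)) (pCons c G) = map_poly of_int (pCons (a * n) (smult d g))"
    proof -
      have "smult (of_int (d * a)) G = map_poly of_int (smult d g)"
        by (simp add: of_int_hom.map_poly_hom_smult flip: ag(2))
      then show ?thesis using nd by (simp add: of_int_hom.map_poly_pCons_hom)
    qed
    moreover have "d * a \<noteq> 0" using ag(1) nd(2) by simp
    ultimately show ?case by blast
  qed
  then show thesis using that by blast
qed

text \<open>Clearing denominators in a factorization gives \<open>smult (a * b) f = g * h\<close>,
  so the prime \<open>f\<close> divides \<open>g\<close> or \<open>h\<close>. That factor then has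
  full degree and the other is constant. Positive degree excludes prime constants, which become
  rational units.\<close>

lemma irreducible_of_int_poly:
  fixes f :: "int poly"
  assumes f: "irreducible f" and deg: "degree f > 0"
  shows "irreducible (map_poly rat_of_int f)"
proof (rule irreducibleI)
  have deg_map: "degree (map_poly rat_of_int q) = degree q" for q by (simp add: degree_map_poly)
  show nz: "map_poly rat_of_int f \<noteq> 0" using deg deg_map[of f] by auto
  show "\<not> is_unit (map_poly rat_of_int f)" using deg deg_map[of f] by (auto simp: is_unit_poly_iff)
  fix G H assume GH: "map_poly rat_of_int f = G * H"
  obtain a g where g: "a \<noteq> 0" "smult (of_int a) G = map_poly of_int g" by (rule clear_denominators)
  obtain b h where h: "b \<noteq> 0" "smult (of_int b) H = map_poly of_int h" by (rule clear_denominators)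
  have "map_poly rat_of_int (smult (a * b) f) = smult (of_int a) G * smult (of_int b) H"
    using GH by (simp add: of_int_hom.map_poly_hom_smult mult.commute)
  also have "\<dots> = map_poly of_int (g * h)" by (simp add: g h of_int_poly_hom.hom_mult)
  finally have "smult (a * b) f = g * h" by simp
  then have "f dvd g * h" by (metis dvd_smult dvd_refl)
  then consider "f dvd g" | "f dvd h" using f prime_elem_dvd_mult_iff irreducible_imp_prime_elem by blast
  moreover have unit: "is_unit Y"
    if XY: "map_poly rat_of_int f = X * Y" and x: "c \<noteq> 0" "smult (of_int c) X = map_poly of_int x"
      and dvd: "f dvd x" for X Y c x
  proof -
    have XY0: "X \<noteq> 0" "Y \<noteq> 0" using XY nz by auto
    have "degree X = degree x" using x deg_map[of x] by (metis degree_smult_eq of_int_eq_0_iff)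
    moreover have "x \<noteq> 0" using x XY0 by auto
    ultimately have "degree f \<le> degree X" using dvd dvd_imp_degree_le by metis
    moreover have "degree f = degree X + degree Y"
      using XY XY0 deg_map[of f] by (simp add: degree_mult_eq)
    ultimately have "degree Y = 0" by simp
    then show ?thesis using XY0 by (simp add: is_unit_iff_degree)
  qed
  ultimately show "is_unit G \<or> is_unit H"
    using unit[OF GH g] unit[OF _ h, of G] GH by (metis mult.commute)
qed

text \<open>A factor that becomes a rational unit is an integer constant dividing \<open>f\<close>,
  hence dividing its content 1.\<close>

lemma irreducible_int_poly_of_rat:
  fixes f :: "int poly"
  assumes f: "irreducible (map_poly rat_of_int f)" and content: "content f = 1"
  shows "irreducible f"
proof (rule irreducibleI)
  show "f \<noteq> 0" using content by auto
  show "\<not> is_unit f"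
  proof
    assume "is_unit f"
    then have "is_unit (map_poly rat_of_int f)"
      by (auto simp: is_unit_poly_iff map_poly_pCons)
    then show False using f by (simp add: irreducible_def)
  qed
  have unit: "is_unit g" if "f = g * h" "is_unit (map_poly rat_of_int g)" for g h
  proof -
    have "degree g = 0" using that(2) by (auto simp: is_unit_iff_degree degree_map_poly)
    then obtain c where c: "g = [:c:]" by (rule degree_eq_zeroE)
    then have "[:c:] dvd f" using that(1) by (metis dvd_triv_left)
    then have "c dvd 1" using content by (metis const_poly_dvd_iff_dvd_content)
    then show ?thesis using c by (simp add: is_unit_const_poly_iff)
  qed
  fix g h assume gh: "f = g * h"
  then have "map_poly rat_of_int f = map_poly of_int g * map_poly of_int h"
    by (simp add: of_int_poly_hom.hom_mult)
  then have "is_unit (map_poly rat_of_int g) \<or> is_unit (map_poly rat_of_int h)"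
    using f irreducibleD by blast
  then show "is_unit g \<or> is_unit h" using unit[of g h] unit[of h g] gh by (auto simp: mult.commute)
qed

theorem corollary4p4:
  fixes f :: "int poly"
  assumes "coeff f 0 \<noteq> 0" and "coeff f 1 \<noteq> 0"
    and "coprime (coeff f 0) (coeff f 1)"
    and "irreducible (map_poly rat_of_int f)"
    and "\<And>(\<alpha>::int) (k::nat). k > 1 \<Longrightarrow> coeff f 0 \<noteq> \<alpha> ^ k \<and> coeff f 0 \<noteq> - (\<alpha> ^ k)"
  shows "strongly_irreducible (map_poly rat_of_int f)"
  unfolding strongly_irreducible_def
proof (intro allI impI)
  fix k :: nat assume k: "k > 0"
  \<comment> \<open>The content divides both coprime coefficients, so \<open>f\<close> is
    primitive.\<close>
  have "is_unit (content f)"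
    using assms(3) by (meson content_dvd_coeff coprime_common_divisor)
  then have "content f = 1" by (metis is_unit_normalize normalize_content)
  then have "irreducible f" using assms(4) by (rule irreducible_int_poly_of_rat[rotated])
  moreover have "\<bar>coeff f 0\<bar> \<noteq> z ^ l" if "l > 1" for z l
    using assms(5)[OF that, of z] by (auto simp: abs_if split: if_splits)
  ultimately have irr: "irreducible (pcompose f (monom 1 k))"
    using assms(1) k by (intro irreducible_pcompose_power)
  \<comment> \<open>The nonzero linear coefficient rules out constants, as the return to rational
    coefficients requires.\<close>
  have "degree f > 0" using le_degree[OF assms(2)] by linarith
  then have "degree (pcompose f (monom 1 k)) > 0"
    using k by (simp add: degree_pcompose degree_monom_eq)
  then have "irreducible (map_poly rat_of_int (pcompose f (monom 1 k)))"
    using irr by (rule irreducible_of_int_poly[rotated])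
  moreover have "map_poly rat_of_int (pcompose f (monom 1 k))
      = pcompose (map_poly rat_of_int f) (monom 1 k)"
    by (rule poly_eqI) (simp add: coeff_map_poly coeff_pcompose_monom k)
  ultimately show "irreducible (pcompose (map_poly rat_of_int f) (monom 1 k))" by simp
qed

end
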